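(* Let $h,k,l,m,n$ be positive integers satisfying $k-1\ge m(n-1)$ and $l-1\ge h(n-1)$. Put $$K=(k-1)n-(m+1)\binom n2\quad\text{and}\quad L=(l-1)n-(h+1)\binom n2 .$$ Let $F$ be a field with $\mathrm{ch}(F)>\max\{K,L\}$. Assume that $c_1,\ldots,c_n\in F$ are distinct and that $A_1,\ldots,A_n,B_1,\ldots,B_n$ are subsets of $F$ with $|A_1|=\cdots=|A_n|=k$ and $|B_1|=\cdots=|B_n|=l$. Let $P_1(x),\ldots,P_n(x),Q_1(x),\ldots,Q_n(x)\in F[x]$ be monic polynomials with $\deg P_i(x)=m$ and $\deg Q_i(x)=h$ for $i=1,\ldots,n$. Then, for any $S,T\subseteq F$ with $|S|\le K$ and $|T|\le L$, there exist $a_1\in A_1,\ldots,a_n\in A_n,\ b_1\in B_1,\ldots,b_n\in B_n$ such that $a_1+\cdots+a_n\notin S$, $b_1+\cdots+b_n\notin T$, and also $$a_ib_ic_i\ne a_jb_jc_j,\quad P_i(a_i)\ne P_j(a_j),\quad Q_i(b_i)\ne Q_j(b_j)\quad\text{whenever } 1\le i<j\le n.$$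
   Context: For a field $F$, $\mathrm{ch}(F)$ denotes the additive order of the multiplicative identity of $F$; it is either a prime or infinite. Thus for fields of characteristic zero in the usual sense, $\mathrm{ch}(F)=+\infty$, and the inequality on $\mathrm{ch}(F)$ holds automatically. *)

theory Defs
  imports "HOL-Library.Extended_Nat" "HOL-Computational_Algebra.Polynomial"
begin

text \<open>
  The additive order of the multiplicative identity of a field, as an extended natural number.
  It agrees with the usual characteristic \<open>CHAR('a)\<close> except that characteristic zero yields
  \<open>\<infinity>\<close> (the infimum of the empty set in \<^typ>\<open>enat\<close>).
\<close>

definition field_ch :: "'a::field itself \<Rightarrow> enat" where
  "field_ch (_ :: 'a itself) = Inf {enat p |p :: nat. p > 0 \<and> of_nat p = (0 :: 'a)}"

lemma field_ch_CHAR: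
  "field_ch TYPE('a::field) = (if CHAR('a) = 0 then \<infinity> else enat CHAR('a))"
proof (cases "CHAR('a) = 0")
  case True
  then have "{enat p |p :: nat. p > 0 \<and> of_nat p = (0 :: 'a)} = {}"
    by (auto simp: of_nat_eq_0_iff_char_dvd)
  then show ?thesis
    using True by (simp add: field_ch_def top_enat_def del: Collect_empty_eq)
next
  case False
  have "Inf {enat p |p :: nat. p > 0 \<and> of_nat p = (0 :: 'a)} = enat CHAR('a)"
  proof (rule antisym)
    show "Inf {enat p |p :: nat. p > 0 \<and> of_nat p = (0 :: 'a)} \<le> enat CHAR('a)"
      using False by (intro Inf_lower) auto
    show "enat CHAR('a) \<le> Inf {enat p |p :: nat. p > 0 \<and> of_nat p = (0 :: 'a)}"
      by (intro Inf_greatest) (auto simp: of_nat_eq_0_iff_char_dvd intro: dvd_imp_le)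
  qed
  then show ?thesis
    using False by (simp add: field_ch_def)
qed

end

theory Submission
  imports Defs "Jordan_Normal_Form.Determinant"
begin

text \<open>
  For a finite set \<open>A\<close> with \<open>k\<close> elements the Lagrange weights give
  \<open>\<Sum>a\<in>A. w a * p a = [x^(k-1)] p\<close> whenever \<open>deg p < k\<close>. The tensor product of these
  functionals over the grid \<open>A\<^sub>1 \<times> \<dots> \<times> A\<^sub>n\<close> is a coefficient extractor, and it plays the role
  of the Combinatorial Nullstellensatz without any multivariate polynomials: if the functional does
  not vanish on a function, then the function is nonzero at some grid point.

  Apply it to the product of the Vandermonde products in \<open>c\<^sub>i x\<^sub>i y\<^sub>i\<close>, \<open>P\<^sub>i(x\<^sub>i)\<close> and
  \<open>Q\<^sub>i(y\<^sub>i)\<close> with monic polynomials of degree \<open>K\<close> and \<open>L\<close> in the two sums that vanish on \<open>S\<close>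
  and \<open>T\<close>. The Leibniz expansion of the first Vandermonde product separates \<open>x\<close> from \<open>y\<close>; the
  term of \<open>\<sigma>\<close> contributes \<open>sgn \<sigma> * M\<close> from \<open>x\<close> and \<open>sgn \<sigma> * N\<close> from \<open>y\<close>, so the total is
  \<open>M * N\<close> times the Vandermonde product of the \<open>c\<^sub>i\<close>. The integer \<open>M\<close> is the alternating sum of
  the multinomial coefficients \<open>K! / \<Prod>\<^sub>i (k - 1 - i - m \<tau>(i))!\<close>, a determinant which
  evaluates to \<open>\<plusminus>K! \<Prod>\<^sub>j m^j j! / (d + m j)!\<close> with \<open>d = k - 1 - m (n - 1)\<close>. Hence \<open>M\<close> divides
  \<open>K!\<close>, and likewise \<open>N\<close> divides \<open>L!\<close>, so neither vanishes in \<open>F\<close>.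
\<close>

section \<open>Vandermonde determinants\<close>

lemma det_monic_basis:
  fixes z :: "nat \<Rightarrow> 'a::idom" and p :: "nat \<Rightarrow> 'a poly"
  assumes "\<And>j. j < n \<Longrightarrow> degree (p j) = j" "\<And>j. j < n \<Longrightarrow> lead_coeff (p j) = 1"
  shows "det (mat n n (\<lambda>(i, j). poly (p j) (z i))) = (\<Prod>j<n. \<Prod>i<j. z j - z i)"
proof -
  \<comment> \<open>All monic bases give the same determinant, and for the Newton basis at \<open>z\<close> the matrix is triangular.\<close>
  have power_basis: "det (mat n n (\<lambda>(i, j). poly (q j) (z i))) = det (mat n n (\<lambda>(i, j). z i ^ j))"
    if q: "\<And>j. j < n \<Longrightarrow> degree (q j) = j" "\<And>j. j < n \<Longrightarrow> lead_coeff (q j) = 1"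
    for q :: "nat \<Rightarrow> 'a poly"
  proof -
    let ?U = "mat n n (\<lambda>(i, j). coeff (q j) i)"
    have "mat n n (\<lambda>(i, j). poly (q j) (z i)) = mat n n (\<lambda>(i, j). z i ^ j) * ?U"
    proof (rule eq_matI)
      fix i j assume "i < dim_row (mat n n (\<lambda>(i, j). z i ^ j) * ?U)"
        "j < dim_col (mat n n (\<lambda>(i, j). z i ^ j) * ?U)"
      then have ij: "i < n" "j < n" by auto
      have "poly (q j) (z i) = (\<Sum>t\<le>j. coeff (q j) t * z i ^ t)"
        using q(1)[OF ij(2)] by (simp add: poly_altdef)
      also have "\<dots> = (\<Sum>t = 0..<n. z i ^ t * coeff (q j) t)"
        using ij q(1)[OF ij(2)]
        by (intro sum.mono_neutral_cong_left) (auto simp: coeff_eq_0)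
      finally show "mat n n (\<lambda>(i, j). poly (q j) (z i)) $$ (i, j)
          = (mat n n (\<lambda>(i, j). z i ^ j) * ?U) $$ (i, j)"
        using ij by (simp add: scalar_prod_def)
    qed auto
    moreover have "det ?U = 1"
    proof -
      have "upper_triangular ?U"
        using q(1) by (auto simp: upper_triangular_def coeff_eq_0)
      then have "det ?U = prod_list (diag_mat ?U)"
        by (intro det_upper_triangular[of _ n]) auto
      also have "\<dots> = (\<Prod>i = 0..<n. ?U $$ (i, i))"
        by (simp add: prod_list_diag_prod)
      also have "\<dots> = 1"
        using q by (intro prod.neutral) (metis (no_types, lifting) atLeastLessThan_iff case_prod_conv index_mat(1))
      finally show ?thesis .
    qed
    ultimately show ?thesis
      by (simp add: det_mult[of _ n])
  qed
  let ?q = "\<lambda>j. \<Prod>t<j. [:- z t, 1:]"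
  let ?N = "mat n n (\<lambda>(i, j). poly (?q j) (z i))"
  have "det (mat n n (\<lambda>(i, j). poly (p j) (z i))) = det (mat n n (\<lambda>(i, j). z i ^ j))"
    using assms by (rule power_basis)
  also have "\<dots> = det ?N"
  proof (rule power_basis[symmetric])
    fix j
    show "degree (?q j) = j" by (simp add: degree_prod_eq_sum_degree)
    show "lead_coeff (?q j) = 1" by (simp only: lead_coeff_prod) simp
  qed
  also have "\<dots> = prod_list (diag_mat ?N)"
    by (rule det_lower_triangular[of n]) (auto simp: poly_prod)
  also have "\<dots> = (\<Prod>j = 0..<n. ?N $$ (j, j))"
    by (simp add: prod_list_diag_prod)
  also have "\<dots> = (\<Prod>j<n. \<Prod>i<j. z j - z i)"
    by (simp add: poly_prod lessThan_atLeast0)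
  finally show ?thesis .
qed

text \<open>Each term is a product of one-variable factors, so a grid functional can be evaluated on
  it coordinate by coordinate.\<close>

lemma Vandermonde_leibniz:
  fixes z :: "nat \<Rightarrow> 'a::idom"
  shows "(\<Prod>j<n. \<Prod>i<j. z j - z i)
    = (\<Sum>\<sigma> | \<sigma> permutes {..<n}. of_int (sign \<sigma>) * (\<Prod>i<n. z i ^ \<sigma> i))"
proof -
  have "(\<Prod>j<n. \<Prod>i<j. z j - z i) = det (mat n n (\<lambda>(i, j). poly (monom 1 j) (z i)))"
    by (rule det_monic_basis[symmetric]) (simp_all add: degree_monom_eq)
  also have "\<dots> = (\<Sum>\<sigma> | \<sigma> permutes {..<n}. of_int (sign \<sigma>) * (\<Prod>i<n. z i ^ \<sigma> i))"
    by (subst det_def'[of _ n])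
      (auto simp: poly_monom lessThan_atLeast0 permutes_in_image intro!: sum.cong prod.cong
        dest: permutes_in_image)
  finally show ?thesis .
qed

section \<open>Lagrange weights and the grid functional\<close>

definition lagrange_weight :: "'a::field set \<Rightarrow> 'a \<Rightarrow> 'a" where
  "lagrange_weight A a = inverse (\<Prod>b\<in>A - {a}. a - b)"

text \<open>Lagrange interpolation on \<open>A\<close> recovers \<open>p\<close>, since both
  polynomials have degree below \<open>card A\<close> and agree on \<open>A\<close>. Each basis
  product \<open>?l a\<close> is monic of degree \<open>card A - 1\<close>, so comparing that
  coefficient gives the weighted sum.\<close>

lemma sum_lagrange_weight:
  fixes p :: "'a::field poly"
  assumes "finite A" "degree p < card A"
  shows "(\<Sum>a\<in>A. lagrange_weight A a * poly p a) = coeff p (card A - 1)"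
proof -
  let ?l = "\<lambda>a. \<Prod>b\<in>A - {a}. [:- b, 1:]"
  let ?q = "\<Sum>a\<in>A. Polynomial.smult (lagrange_weight A a * poly p a) (?l a)"
  have deg: "degree (?l a) = card A - 1" if "a \<in> A" for a
    using that assms by (simp add: degree_prod_eq_sum_degree)
  have lc: "coeff (?l a) (card A - 1) = 1" if "a \<in> A" for a
    using lead_coeff_prod[of "\<lambda>b. [:- b, 1:]" "A - {a}"] deg[OF that] by simp
  have "p = ?q"
  proof (rule poly_eqI_degree[of A])
    fix x assume x: "x \<in> A"
    have "poly ?q x = (\<Sum>a\<in>A. lagrange_weight A a * poly p a * (\<Prod>b\<in>A - {a}. x - b))"
      by (simp add: poly_sum poly_prod)
    also have "\<dots> = (\<Sum>a\<in>{x}. lagrange_weight A a * poly p a * (\<Prod>b\<in>A - {a}. x - b))"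
      using x assms by (intro sum.mono_neutral_right) auto
    also have "\<dots> = poly p x"
      using assms by (simp add: lagrange_weight_def)
    finally show "poly p x = poly ?q x" by simp
  next
    have "degree ?q \<le> card A - 1"
      using deg by (intro degree_sum_le assms) (simp add: degree_smult_eq)
    then show "degree ?q < card A" using assms by linarith
  qed (use assms in auto)
  then have "coeff p (card A - 1) = coeff ?q (card A - 1)" by simp
  also have "\<dots> = (\<Sum>a\<in>A. lagrange_weight A a * poly p a)"
    using lc by (simp add: coeff_sum)
  finally show ?thesis by simp
qed

definition grid_functional ::
  "nat \<Rightarrow> (nat \<Rightarrow> 'a::field set) \<Rightarrow> ((nat \<Rightarrow> 'a) \<Rightarrow> 'a) \<Rightarrow> 'a" where
  "grid_functional n A f = (\<Sum>x\<in>PiE {..<n} A. (\<Prod>i<n. lagrange_weight (A i) (x i)) * f x)"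

lemma grid_functional_sum:
  "grid_functional n A (\<lambda>x. \<Sum>t\<in>I. f t x) = (\<Sum>t\<in>I. grid_functional n A (f t))"
  unfolding grid_functional_def by (simp add: sum_distrib_left) (rule sum.swap)

lemma grid_functional_cmult:
  "grid_functional n A (\<lambda>x. d * f x) = d * grid_functional n A f"
  unfolding grid_functional_def by (simp add: sum_distrib_left mult_ac)

lemma grid_functional_prod:
  assumes "\<And>i. i < n \<Longrightarrow> finite (A i)"
  shows "grid_functional n A (\<lambda>x. \<Prod>i<n. g i (x i))
    = (\<Prod>i<n. \<Sum>a\<in>A i. lagrange_weight (A i) a * g i a)"
  unfolding grid_functional_def using assms
  by (subst prod_sum_PiE) (auto simp: prod.distrib)

section \<open>Multinomial coefficients\<close>

text \<open>
  Entries are integers so that the recursion needs no side conditions: an entry that has become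
  negative never returns to zero, hence it makes the value zero.
\<close>

fun multinom :: "nat \<Rightarrow> nat \<Rightarrow> (nat \<Rightarrow> int) \<Rightarrow> int" where
  "multinom n 0 r = (if \<forall>i<n. r i = 0 then 1 else 0)"
| "multinom n (Suc K) r = (\<Sum>i<n. multinom n K (r(i := r i - 1)))"

text \<open>Extending \<open>1 / r!\<close> by zero to negative integers makes
  \<open>inv_fact (r - 1) = r * inv_fact r\<close> true for every integer \<open>r\<close>,
  including \<open>r = 0\<close>.\<close>

definition inv_fact :: "int \<Rightarrow> real" where
  "inv_fact r = (if r < 0 then 0 else 1 / fact (nat r))"

lemma inv_fact_diff_1: "inv_fact (r - 1) = of_int r * inv_fact r"
proof (cases "r > 0")
  case True
  then obtain t where "r = int (Suc t)" by (metis gr0_conv_Suc pos_int_cases)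
  moreover have "1 / fact t = real (Suc t) * (1 / fact (Suc t))"
    by (simp del: of_nat_Suc)
  moreover have "nat (int (Suc t) - 1) = t" by simp
  ultimately show ?thesis by (simp add: inv_fact_def del: fact_Suc of_nat_Suc)
qed (auto simp: inv_fact_def)

text \<open>Lowering entry \<open>i\<close> multiplies the product of the
  \<open>inv_fact (r j)\<close> by \<open>r i\<close>; summing over \<open>i\<close> gives the
  factor \<open>Suc K\<close> that turns \<open>fact K\<close> into
  \<open>fact (Suc K)\<close>.\<close>

lemma multinom_eq:
  assumes "(\<Sum>i<n. r i) = int K"
  shows "real_of_int (multinom n K r) = fact K * (\<Prod>i<n. inv_fact (r i))"
  using assms
proof (induction K arbitrary: r)
  case 0
  show ?case
  proof (cases "\<forall>i<n. r i = 0")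
    case True
    then show ?thesis by (simp add: inv_fact_def)
  next
    case False
    \<comment> \<open>Entries that sum to zero but are not all zero include a negative one, where
      \<open>inv_fact\<close> is 0.\<close>
    have "\<exists>i<n. r i < 0"
    proof (rule ccontr)
      assume "\<not> ?thesis"
      then have "\<forall>i\<in>{..<n}. r i = 0"
        using 0 sum_nonneg_eq_0_iff[of "{..<n}" r] by force
      with False show False by auto
    qed
    with False show ?thesis by (auto simp: inv_fact_def)
  qed
next
  case (Suc K)
  have "real_of_int (multinom n K (r(i := r i - 1)))
      = fact K * (of_int (r i) * (\<Prod>j<n. inv_fact (r j)))" if i: "i < n" for i
  proof -
    have "(\<Sum>j<n. (r(i := r i - 1)) j) = (\<Sum>j<n. r j - (if j = i then 1 else 0))"
      by (intro sum.cong) auto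
    also have "\<dots> = int K" using i Suc.prems by (simp add: sum_subtractf)
    finally have "real_of_int (multinom n K (r(i := r i - 1)))
        = fact K * (\<Prod>j<n. inv_fact ((r(i := r i - 1)) j))" by (rule Suc.IH)
    also have "(\<Prod>j<n. inv_fact ((r(i := r i - 1)) j))
        = (\<Prod>j<n. (if j = i then of_int (r i) else 1) * inv_fact (r j))"
      by (intro prod.cong) (auto simp: inv_fact_diff_1)
    also have "\<dots> = of_int (r i) * (\<Prod>j<n. inv_fact (r j))"
      using i by (simp add: prod.distrib)
    finally show ?thesis .
  qed
  then have "real_of_int (multinom n (Suc K) r)
      = (\<Sum>i<n. of_int (r i) * (fact K * (\<Prod>j<n. inv_fact (r j))))"
    by (simp add: mult_ac)
  also have "\<dots> = of_int (\<Sum>i<n. r i) * (fact K * (\<Prod>j<n. inv_fact (r j)))"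
    by (simp only: sum_distrib_right of_int_sum)
  finally show ?case using Suc.prems by (simp add: algebra_simps)
qed

section \<open>Values of the grid functional on polynomials\<close>

text \<open>Induction on \<open>r\<close>: one factor of the power is expanded and its summand
  \<open>x j\<close> is absorbed into \<open>p j\<close>. This raises \<open>e j\<close> by one and
  thus follows the recursion of \<open>multinom\<close>.\<close>

lemma grid_functional_prod_poly_power:
  fixes p :: "nat \<Rightarrow> 'a::field poly"
  assumes A: "\<And>i. i < n \<Longrightarrow> finite (A i) \<and> card (A i) = k" and "k > 0"
    and "\<And>i. i < n \<Longrightarrow> degree (p i) \<le> e i"
    and "(\<Sum>i<n. e i) + r = n * (k - 1)"
  shows "grid_functional n A (\<lambda>x. (\<Prod>i<n. poly (p i) (x i)) * (\<Sum>i<n. x i) ^ r)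
    = (\<Prod>i<n. coeff (p i) (e i)) * of_int (multinom n r (\<lambda>i. int k - 1 - int (e i)))"
  using assms(3,4)
proof (induction r arbitrary: p e)
  case 0
  have *: "grid_functional n A (\<lambda>x. \<Prod>i<n. poly (p i) (x i))
      = (\<Prod>i<n. \<Sum>a\<in>A i. lagrange_weight (A i) a * poly (p i) a)"
    using A by (intro grid_functional_prod) auto
  show ?case
  proof (cases "\<forall>i<n. e i = k - 1")
    case True
    have "(\<Sum>a\<in>A i. lagrange_weight (A i) a * poly (p i) a) = coeff (p i) (e i)" if "i < n" for i
      using A[OF that] \<open>k > 0\<close> 0(1)[OF that] True that by (subst sum_lagrange_weight) auto
    with * True \<open>k > 0\<close> show ?thesis by (simp add: of_nat_diff)
  next
    case False
    \<comment> \<open>The \<open>e i\<close> sum to \<open>n * (k - 1)\<close>, so if they are not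
      all \<open>k - 1\<close>, one lies below; its one-variable factor is zero, and so is
      \<open>multinom\<close>.\<close>
    have "\<exists>i<n. e i < k - 1"
    proof (rule ccontr)
      assume "\<not> ?thesis"
      then have ge: "\<And>i. i < n \<Longrightarrow> k - 1 \<le> e i" by force
      obtain i where "i < n" "e i > k - 1" using False ge by (metis le_neq_implies_less)
      then have "(\<Sum>i<n. k - 1) < (\<Sum>i<n. e i)"
        using ge by (intro sum_strict_mono_ex1) auto
      with 0 show False by simp
    qed
    then obtain i where i: "i < n" "e i < k - 1" by blast
    then have "degree (p i) < k - 1" using 0(1) by force
    then have "(\<Sum>a\<in>A i. lagrange_weight (A i) a * poly (p i) a) = 0"
      using A i by (subst sum_lagrange_weight) (auto simp: coeff_eq_0)
    then have "(\<Prod>i<n. \<Sum>a\<in>A i. lagrange_weight (A i) a * poly (p i) a) = 0"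
      using i by (intro prod_zero) auto
    then show ?thesis using * i by (auto simp: of_nat_diff)
  qed
next
  case (Suc r)
  \<comment> \<open>Prepending 0 multiplies by the variable and moves the coefficient at
    \<open>e j\<close> to \<open>Suc (e j)\<close>, so the product of coefficients is
    unchanged.\<close>
  let ?p = "\<lambda>j. p(j := pCons 0 (p j))" and ?e = "\<lambda>j. e(j := Suc (e j))"
  have step: "(\<Prod>i<n. poly (p i) (x i)) * x j = (\<Prod>i<n. poly (?p j i) (x i))"
    if "j < n" for x j
  proof -
    have "(\<Prod>i<n. poly (?p j i) (x i)) = (\<Prod>i<n. (if i = j then x j else 1) * poly (p i) (x i))"
      by (intro prod.cong) auto
    then show ?thesis using that by (simp add: prod.distrib mult.commute)
  qed
  have "grid_functional n A (\<lambda>x. (\<Prod>i<n. poly (p i) (x i)) * (\<Sum>i<n. x i) ^ Suc r)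
      = grid_functional n A (\<lambda>x. \<Sum>j<n. (\<Prod>i<n. poly (?p j i) (x i)) * (\<Sum>i<n. x i) ^ r)"
  proof (intro arg_cong[where f = "grid_functional n A"] ext)
    fix x
    have "(\<Prod>i<n. poly (p i) (x i)) * (\<Sum>i<n. x i) ^ Suc r
        = (\<Sum>j<n. (\<Prod>i<n. poly (p i) (x i)) * x j * (\<Sum>i<n. x i) ^ r)"
      by (simp add: sum_distrib_left sum_distrib_right mult.assoc)
    also have "\<dots> = (\<Sum>j<n. (\<Prod>i<n. poly (?p j i) (x i)) * (\<Sum>i<n. x i) ^ r)"
      by (intro sum.cong refl) (simp only: step lessThan_iff)
    finally show "(\<Prod>i<n. poly (p i) (x i)) * (\<Sum>i<n. x i) ^ Suc r
        = (\<Sum>j<n. (\<Prod>i<n. poly (?p j i) (x i)) * (\<Sum>i<n. x i) ^ r)" .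
  qed
  also have "\<dots> = (\<Sum>j<n. grid_functional n A
      (\<lambda>x. (\<Prod>i<n. poly (?p j i) (x i)) * (\<Sum>i<n. x i) ^ r))"
    by (rule grid_functional_sum)
  also have "\<dots> = (\<Sum>j<n. (\<Prod>i<n. coeff (?p j i) (?e j i)) *
      of_int (multinom n r (\<lambda>i. int k - 1 - int (?e j i))))"
  proof (intro sum.cong refl Suc.IH)
    fix j i assume "j \<in> {..<n}" "i < n"
    then show "degree (?p j i) \<le> ?e j i" using Suc.prems(1)[of i] Suc.prems(1)[of j]
      by (auto simp: degree_pCons_eq_if)
  next
    fix j assume j: "j \<in> {..<n}"
    have "(\<Sum>i<n. ?e j i) = (\<Sum>i<n. e i + (if i = j then 1 else 0))"
      by (intro sum.cong) auto
    then show "(\<Sum>i<n. ?e j i) + r = n * (k - 1)"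
      using j Suc.prems(2) by (simp add: sum.distrib)
  qed
  also have "\<dots> = (\<Sum>j<n. (\<Prod>i<n. coeff (p i) (e i)) *
      of_int (multinom n r ((\<lambda>i. int k - 1 - int (e i))(j := int k - 1 - int (e j) - 1))))"
  proof (intro sum.cong refl arg_cong2[where f = "(*)"] prod.cong)
    fix j
    show "(of_int (multinom n r (\<lambda>i. int k - 1 - int (?e j i))) :: 'a) =
      of_int (multinom n r ((\<lambda>i. int k - 1 - int (e i))(j := int k - 1 - int (e j) - 1)))"
      by (intro arg_cong[where f = "\<lambda>f. of_int (multinom n r f)"]) auto
  qed auto
  finally show ?case by (simp add: sum_distrib_left)
qed

lemma grid_functional_nonzeroD:
  assumes "grid_functional n A f \<noteq> 0"
  shows "\<exists>x. (\<forall>i<n. x i \<in> A i) \<and> f x \<noteq> 0"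
proof -
  obtain x where "x \<in> PiE {..<n} A" "(\<Prod>i<n. lagrange_weight (A i) (x i)) * f x \<noteq> 0"
    using assms unfolding grid_functional_def by (rule sum.not_neutral_contains_not_neutral)
  then show ?thesis by (intro exI[of _ x]) auto
qed

text \<open>The functional kills total degree below \<open>n * (k - 1)\<close>, so only the
  coefficient of \<open>s\<close> at \<open>K\<close> contributes.\<close>

lemma grid_functional_prod_poly:
  fixes p :: "nat \<Rightarrow> 'a::field poly"
  assumes A: "\<And>i. i < n \<Longrightarrow> finite (A i) \<and> card (A i) = k" and "k > 0" "n > 0"
    and p: "\<And>i. i < n \<Longrightarrow> degree (p i) \<le> e i"
    and "degree s \<le> K" and total: "(\<Sum>i<n. e i) + K = n * (k - 1)"
  shows "grid_functional n A (\<lambda>x. (\<Prod>i<n. poly (p i) (x i)) * poly s (\<Sum>i<n. x i))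
    = coeff s K * ((\<Prod>i<n. coeff (p i) (e i)) * of_int (multinom n K (\<lambda>i. int k - 1 - int (e i))))"
proof -
  let ?F = "\<lambda>r. grid_functional n A (\<lambda>x. (\<Prod>i<n. poly (p i) (x i)) * (\<Sum>i<n. x i) ^ r)"
  have poly_s: "poly s y = (\<Sum>r\<le>K. coeff s r * y ^ r)" for y
    unfolding poly_altdef using \<open>degree s \<le> K\<close>
    by (intro sum.mono_neutral_left) (auto simp: coeff_eq_0)
  \<comment> \<open>Raising \<open>e 0\<close> restores the total degree, and the coefficient of \<open>p 0\<close> there is zero.\<close>
  have lower: "?F r = 0" if "r < K" for r
  proof -
    let ?e = "e(0 := e 0 + (K - r))"
    have "(\<Sum>i<n. ?e i) = (\<Sum>i<n. e i + (if i = 0 then K - r else 0))"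
      by (intro sum.cong) auto
    then have "(\<Sum>i<n. ?e i) + r = n * (k - 1)"
      using \<open>n > 0\<close> that total by (simp add: sum.distrib)
    moreover have "degree (p i) \<le> ?e i" if "i < n" for i
      using p[OF that] by auto
    ultimately have "?F r = (\<Prod>i<n. coeff (p i) (?e i)) *
        of_int (multinom n r (\<lambda>i. int k - 1 - int (?e i)))"
      using A \<open>k > 0\<close> by (intro grid_functional_prod_poly_power) auto
    moreover have "coeff (p 0) (?e 0) = 0"
      using p[OF \<open>n > 0\<close>] that by (simp add: coeff_eq_0)
    then have "(\<Prod>i<n. coeff (p i) (?e i)) = 0"
      using \<open>n > 0\<close> by (intro prod_zero) auto
    ultimately show ?thesis by simp
  qed
  have "grid_functional n A (\<lambda>x. (\<Prod>i<n. poly (p i) (x i)) * poly s (\<Sum>i<n. x i))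
      = grid_functional n A (\<lambda>x. \<Sum>r\<le>K. coeff s r * ((\<Prod>i<n. poly (p i) (x i)) * (\<Sum>i<n. x i) ^ r))"
    by (intro arg_cong[where f = "grid_functional n A"] ext) (simp add: poly_s sum_distrib_left mult_ac)
  also have "\<dots> = (\<Sum>r\<le>K. coeff s r * ?F r)"
    by (simp add: grid_functional_sum grid_functional_cmult)
  also have "\<dots> = (\<Sum>r\<in>{K}. coeff s r * ?F r)"
    using lower by (intro sum.mono_neutral_right) auto
  also have "\<dots> = coeff s K * ?F K" by simp
  also have "?F K = (\<Prod>i<n. coeff (p i) (e i)) * of_int (multinom n K (\<lambda>i. int k - 1 - int (e i)))"
    using A \<open>k > 0\<close> p total by (intro grid_functional_prod_poly_power) auto
  finally show ?thesis .
qed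

section \<open>Alternating sums of multinomial coefficients\<close>

text \<open>Here \<open>\<tau>\<close> indexes the Leibniz expansion of the Vandermonde product in
  the \<open>poly (P i) (x i)\<close>, and \<open>\<sigma> i + m * \<tau> i\<close> is the degree of
  its term in \<open>x i\<close> after multiplication by \<open>x i ^ \<sigma> i\<close>.\<close>

definition alt_multinom :: "nat \<Rightarrow> nat \<Rightarrow> nat \<Rightarrow> nat \<Rightarrow> (nat \<Rightarrow> nat) \<Rightarrow> int" where
  "alt_multinom n k m K \<sigma> = (\<Sum>\<tau> | \<tau> permutes {..<n}.
     sign \<tau> * multinom n K (\<lambda>i. int k - 1 - int (\<sigma> i + m * \<tau> i)))"

lemma sum_permutes:
  assumes "\<sigma> permutes {..<n}"
  shows "(\<Sum>i<n. \<sigma> i) = n choose 2"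
proof -
  have "(\<Sum>i<n. \<sigma> i) = (\<Sum>i<n. i)"
    using sum.permute[OF assms, of "\<lambda>i. i"] by simp
  also have "\<dots> = n choose 2"
    by (simp add: lessThan_atLeast0 Sum_Ico_nat choose_two)
  finally show ?thesis .
qed

text \<open>The term of \<open>\<tau>\<close> is a product of monic polynomials whose degrees sum to
  \<open>(m + 1) * (n choose 2)\<close> for every \<open>\<tau>\<close>, so \<open>K\<close> is
  exactly the missing degree. Only leading coefficients enter, and these are all 1.\<close>

lemma grid_functional_Vandermonde:
  fixes P :: "nat \<Rightarrow> 'a::field poly"
  assumes A: "\<And>i. i < n \<Longrightarrow> finite (A i) \<and> card (A i) = k" and "k > 0" "n > 0"
    and P: "\<And>i. i < n \<Longrightarrow> lead_coeff (P i) = 1 \<and> degree (P i) = m"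
    and s: "lead_coeff s = 1" "degree s = K"
    and K: "K + (m + 1) * (n choose 2) = n * (k - 1)"
    and \<sigma>: "\<sigma> permutes {..<n}"
  shows "grid_functional n A (\<lambda>x. (\<Prod>i<n. x i ^ \<sigma> i) *
      ((\<Prod>j<n. \<Prod>i<j. poly (P j) (x j) - poly (P i) (x i)) * poly s (\<Sum>i<n. x i)))
    = of_int (alt_multinom n k m K \<sigma>)"
proof -
  let ?p = "\<lambda>\<tau> i. monom 1 (\<sigma> i) * P i ^ \<tau> i"
  let ?e = "\<lambda>\<tau> i. \<sigma> i + m * \<tau> i"
  have deg: "degree (?p \<tau> i) = ?e \<tau> i" if "i < n" for \<tau> i
  proof -
    have "P i \<noteq> 0" using P[OF that] by auto
    then show ?thesis using P[OF that]
      by (subst degree_mult_eq) (auto simp: degree_monom_eq degree_power_eq)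
  qed
  have lc: "coeff (?p \<tau> i) (?e \<tau> i) = 1" if "i < n" for \<tau> i
  proof -
    have "lead_coeff (?p \<tau> i) = 1"
      by (simp only: lead_coeff_mult lead_coeff_power lead_coeff_monom 
        conjunct1[OF P[OF that]] power_one mult_1_left)
    then show ?thesis by (simp only: deg[OF that])
  qed
  have total: "(\<Sum>i<n. ?e \<tau> i) + K = n * (k - 1)" if "\<tau> permutes {..<n}" for \<tau>
    using sum_permutes[OF \<sigma>] sum_permutes[OF that] K
    by (simp add: sum.distrib sum_distrib_left[symmetric])
  have "grid_functional n A (\<lambda>x. (\<Prod>i<n. x i ^ \<sigma> i) *
      ((\<Prod>j<n. \<Prod>i<j. poly (P j) (x j) - poly (P i) (x i)) * poly s (\<Sum>i<n. x i)))
    = grid_functional n A (\<lambda>x. \<Sum>\<tau> | \<tau> permutes {..<n}. of_int (sign \<tau>) *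
        ((\<Prod>i<n. poly (?p \<tau> i) (x i)) * poly s (\<Sum>i<n. x i)))"
    unfolding Vandermonde_leibniz
    by (intro arg_cong[where f = "grid_functional n A"] ext)
      (simp add: sum_distrib_left sum_distrib_right prod.distrib poly_monom mult_ac)
  also have "\<dots> = (\<Sum>\<tau> | \<tau> permutes {..<n}. of_int (sign \<tau>) *
      grid_functional n A (\<lambda>x. (\<Prod>i<n. poly (?p \<tau> i) (x i)) * poly s (\<Sum>i<n. x i)))"
    by (simp only: grid_functional_sum grid_functional_cmult)
  also have "\<dots> = (\<Sum>\<tau> | \<tau> permutes {..<n}. of_int (sign \<tau>) *
      of_int (multinom n K (\<lambda>i. int k - 1 - int (?e \<tau> i))))"
  proof (intro sum.cong refl arg_cong2[where f = "(*)"])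
    fix \<tau> assume "\<tau> \<in> {\<tau>. \<tau> permutes {..<n}}"
    then have "grid_functional n A (\<lambda>x. (\<Prod>i<n. poly (?p \<tau> i) (x i)) * poly s (\<Sum>i<n. x i))
      = coeff s K * ((\<Prod>i<n. coeff (?p \<tau> i) (?e \<tau> i)) *
          of_int (multinom n K (\<lambda>i. int k - 1 - int (?e \<tau> i))))"
      using A \<open>k > 0\<close> \<open>n > 0\<close> s total deg by (intro grid_functional_prod_poly) auto
    then show "grid_functional n A (\<lambda>x. (\<Prod>i<n. poly (?p \<tau> i) (x i)) * poly s (\<Sum>i<n. x i))
      = of_int (multinom n K (\<lambda>i. int k - 1 - int (?e \<tau> i)))"
      using s by (simp add: lc del: of_nat_add of_nat_mult)
  qed
  finally show ?thesis by (simp add: alt_multinom_def)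
qed

text \<open>By the factorial formula for \<open>multinom\<close>, the sum over \<open>\<tau>\<close>
  is \<open>fact K\<close> times the Leibniz expansion of the matrix with rows permuted by
  \<open>\<sigma>\<close>.\<close>

lemma alt_multinom_eq_det:
  assumes K: "K + (m + 1) * (n choose 2) = n * (k - 1)" and "k > 0"
    and \<sigma>: "\<sigma> permutes {..<n}"
  shows "real_of_int (alt_multinom n k m K \<sigma>) = of_int (sign \<sigma>) *
    (fact K * det (mat n n (\<lambda>(i, j). inv_fact (int k - 1 - int (i + m * j)))))"
proof -
  let ?D = "mat n n (\<lambda>(i, j). inv_fact (int k - 1 - int (i + m * j)))"
  have mult: "real_of_int (multinom n K (\<lambda>i. int k - 1 - int (\<sigma> i + m * \<tau> i)))
      = fact K * (\<Prod>i<n. inv_fact (int k - 1 - int (\<sigma> i + m * \<tau> i)))"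
    if \<tau>: "\<tau> permutes {..<n}" for \<tau>
  proof (rule multinom_eq)
    have "(\<Sum>i<n. int (\<sigma> i + m * \<tau> i)) = int ((\<Sum>i<n. \<sigma> i) + m * (\<Sum>i<n. \<tau> i))"
      by (simp add: sum.distrib sum_distrib_left)
    also have "\<dots> = int ((m + 1) * (n choose 2))"
      by (simp add: sum_permutes[OF \<sigma>] sum_permutes[OF \<tau>])
    finally have "(\<Sum>i<n. int k - 1 - int (\<sigma> i + m * \<tau> i))
        = int n * (int k - 1) - int ((m + 1) * (n choose 2))"
      by (simp add: sum_subtractf)
    moreover have "int K + int ((m + 1) * (n choose 2)) = int n * (int k - 1)"
      using K \<open>k > 0\<close> by (metis of_nat_add of_nat_mult of_nat_diff of_nat_1 Suc_leI One_nat_def)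
    ultimately show "(\<Sum>i<n. int k - 1 - int (\<sigma> i + m * \<tau> i)) = int K" by linarith
  qed
  have \<sigma>': "\<sigma> permutes {0..<n}" using \<sigma> by (simp add: lessThan_atLeast0)
  have "real_of_int (alt_multinom n k m K \<sigma>) = (\<Sum>\<tau> | \<tau> permutes {..<n}. of_int (sign \<tau>) *
     (fact K * (\<Prod>i<n. inv_fact (int k - 1 - int (\<sigma> i + m * \<tau> i)))))"
    unfolding alt_multinom_def of_int_sum of_int_mult
    by (intro sum.cong refl) (simp only: mult mem_Collect_eq)
  also have "\<dots> = fact K * det (mat n n (\<lambda>(i, j). ?D $$ (\<sigma> i, j)))"
    using permutes_in_image[OF \<sigma>']
    by (subst det_def'[of _ n]) (auto simp: sum_distrib_left lessThan_atLeast0 permutes_in_image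
      mult_ac intro!: sum.cong prod.cong)
  also have "det (mat n n (\<lambda>(i, j). ?D $$ (\<sigma> i, j))) = of_int (sign \<sigma>) * det ?D"
    using \<sigma>' by (intro det_permute_rows) auto
  finally show ?thesis by (simp add: mult_ac)
qed

lemma alt_multinom_permute:
  assumes "K + (m + 1) * (n choose 2) = n * (k - 1)" "k > 0" "\<sigma> permutes {..<n}"
  shows "alt_multinom n k m K \<sigma> = sign \<sigma> * alt_multinom n k m K id"
proof -
  have "real_of_int (alt_multinom n k m K \<sigma>) = real_of_int (sign \<sigma> * alt_multinom n k m K id)"
    using alt_multinom_eq_det[OF assms] alt_multinom_eq_det[OF assms(1,2) permutes_id]
    by (simp add: sign_id)
  then show ?thesis by linarith
qed

section \<open>Evaluation of the determinant and divisibility\<close>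

text \<open>The polynomial is the falling factorial, monic of degree \<open>j\<close>. For
  \<open>0 \<le> a < j\<close> one of its roots is \<open>a\<close>, which matches the value 0 on
  the left.\<close>

lemma inv_fact_diff:
  "inv_fact (a - int j) = inv_fact a * poly (\<Prod>t<j. [:- real t, 1:]) (of_int a)"
proof (induction j)
  case (Suc j)
  have "inv_fact (a - int (Suc j)) = of_int (a - int j) * inv_fact (a - int j)"
    using inv_fact_diff_1[of "a - int j"] by (simp add: algebra_simps)
  then show ?case using Suc by (simp add: algebra_simps)
qed simp

text \<open>Among the factors of \<open>(m * j)!\<close> are \<open>m, 2 * m, ..., j * m\<close>,
  whose product is \<open>m ^ j * j!\<close>.\<close>

lemma power_mult_fact_dvd:
  assumes "m > 0"
  shows "m ^ j * fact j dvd (fact (d + m * j) :: nat)"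
proof -
  have "m ^ j * fact j dvd (fact (m * j) :: nat)"
  proof (induction j)
    case (Suc j)
    obtain m' where m': "m = Suc m'" using assms gr0_conv_Suc by blast
    have "fact (m * j) dvd (fact (m * j + m') :: nat)" by (rule fact_dvd) simp
    with Suc have "m ^ j * fact j dvd (fact (m * j + m') :: nat)" by (rule dvd_trans)
    then have "(m * Suc j) * (m ^ j * fact j) dvd (m * Suc j) * (fact (m * j + m') :: nat)"
      by (rule mult_dvd_mono[OF dvd_refl])
    moreover have "m * Suc j = Suc (m * j + m')" by (simp add: m')
    then have "fact (m * Suc j) = (m * Suc j) * (fact (m * j + m') :: nat)"
      by (metis fact_Suc of_nat_id)
    moreover have "m ^ Suc j * fact (Suc j) = (m * Suc j) * (m ^ j * fact j)"
      by (simp add: algebra_simps)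
    ultimately show ?case by (simp only:)
  qed simp
  also have "fact (m * j) dvd (fact (d + m * j) :: nat)" by (rule fact_dvd) simp
  finally show ?thesis .
qed

lemma alt_multinom_dvd_fact:
  assumes K: "K + (m + 1) * (n choose 2) = n * (k - 1)" and "k > 0" "m > 0"
    and km: "m * (n - 1) \<le> k - 1"
  shows "alt_multinom n k m K id dvd fact K"
proof -
  \<comment> \<open>By \<open>km\<close> the subtraction is not truncated for \<open>i < n\<close>,
    and \<open>d\<close> is the least value, \<open>a (n - 1)\<close>.\<close>
  define a where "a = (\<lambda>i. k - 1 - m * i)"
  define d where "d = k - 1 - m * (n - 1)"
  have a: "int (a i) = int k - 1 - int (m * i)" "a (n - Suc i) = d + m * i" if "i < n" for i
  proof -
    have "m * i \<le> m * (n - 1)" using that by (intro mult_le_mono2) linarith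
    then have "m * i \<le> k - 1" using km by linarith
    then show "int (a i) = int k - 1 - int (m * i)" using \<open>k > 0\<close> by (simp add: a_def of_nat_diff)
    have "m * (n - Suc i) + m * i = m * (n - 1)"
      using that by (simp add: add_mult_distrib2[symmetric])
    then show "a (n - Suc i) = d + m * i" using km unfolding a_def d_def by linarith
  qed
  \<comment> \<open>This natural number turns out to be the reciprocal of the absolute value of
    \<open>det ?D\<close>, hence the cofactor in the divisibility.\<close>
  define q where "q = (\<Prod>j<n. fact (d + m * j) div (m ^ j * fact j :: nat))"
  let ?D = "mat n n (\<lambda>(i, j). inv_fact (int k - 1 - int (i + m * j)))"
  let ?f = "\<lambda>j. \<Prod>t<j. [:- real t, 1:]"
  \<comment> \<open>After transposing, row \<open>i\<close> has entries
    \<open>inv_fact (a i - j)\<close>: the factor \<open>1 / fact (a i)\<close> comes out of the row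
    and leaves a monic polynomial of degree \<open>j\<close> evaluated at
    \<open>a i\<close>.\<close>
  have "det ?D = det (transpose_mat ?D)" by (rule det_transpose[symmetric, of _ n]) simp
  also have "\<dots> = (\<Prod>i<n. 1 / fact (a i)) * det (mat n n (\<lambda>(i, j). poly (?f j) (real (a i))))"
  proof -
    have "inv_fact (int k - 1 - int (j + m * i)) = 1 / fact (a i) * poly (?f j) (real (a i))"
      if "i < n" for i j
    proof -
      have "int k - 1 - int (j + m * i) = int (a i) - int j" using a(1)[OF that] by simp
      then show ?thesis by (simp only: inv_fact_diff) (simp add: inv_fact_def)
    qed
    then show ?thesis
      by (subst (1 2) det_def'[of _ n])
        (auto simp: sum_distrib_left lessThan_atLeast0 prod.distrib prod_dividef
          permutes_in_image mult_ac simp del: of_nat_add of_nat_mult intro!: sum.cong prod.cong)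
  qed
  also have "det (mat n n (\<lambda>(i, j). poly (?f j) (real (a i)))) = (\<Prod>j<n. \<Prod>i<j. real (a j) - real (a i))"
  proof (rule det_monic_basis)
    fix j
    show "degree (?f j) = j" by (simp add: degree_prod_eq_sum_degree)
    show "lead_coeff (?f j) = 1" by (simp only: lead_coeff_prod) simp
  qed
  finally have det: "det ?D = (\<Prod>i<n. 1 / fact (a i)) * (\<Prod>j<n. \<Prod>i<j. real (a j) - real (a i))" .
  \<comment> \<open>Pairing the row factor \<open>m ^ j * fact j\<close> with \<open>fact (a (n - Suc j))\<close> makes the quotients integers.\<close>
  have "\<bar>\<Prod>j<n. \<Prod>i<j. real (a j) - real (a i)\<bar> = (\<Prod>j<n. real (m ^ j * fact j))"
    unfolding abs_prod
  proof (intro prod.cong refl)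
    fix j assume j: "j \<in> {..<n}"
    have "(\<Prod>i<j. \<bar>real (a j) - real (a i)\<bar>) = (\<Prod>i<j. real (m * (j - i)))"
    proof (intro prod.cong refl)
      fix i assume i: "i \<in> {..<j}"
      have "int (a j) - int (a i) = - int (m * (j - i))"
        using a(1)[of i] a(1)[of j] i j by (simp add: algebra_simps of_nat_diff)
      then have "real_of_int (int (a j) - int (a i)) = real_of_int (- int (m * (j - i)))" by simp
      then show "\<bar>real (a j) - real (a i)\<bar> = real (m * (j - i))" by simp
    qed
    also have "\<dots> = real (m ^ j * fact j)"
      by (simp add: prod.distrib fact_prod_rev lessThan_atLeast0)
    finally show "(\<Prod>i<j. \<bar>real (a j) - real (a i)\<bar>) = real (m ^ j * fact j)" .
  qed
  moreover have "(\<Prod>i<n. 1 / fact (a i)) = (\<Prod>i<n. 1 / (fact (d + m * i) :: real))"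
    by (subst prod.nat_diff_reindex[symmetric]) (auto intro!: prod.cong simp: a(2))
  ultimately have "\<bar>det ?D\<bar> = (\<Prod>j<n. real (m ^ j * fact j) / fact (d + m * j))"
    unfolding det abs_mult by (simp add: abs_prod prod_dividef)
  moreover have "real q = (\<Prod>j<n. fact (d + m * j) / real (m ^ j * fact j))"
    unfolding q_def of_nat_prod
    by (intro prod.cong refl) (simp add: real_of_nat_div power_mult_fact_dvd[OF \<open>m > 0\<close>])
  ultimately have "\<bar>det ?D\<bar> * real q = 1"
    using \<open>m > 0\<close> by (simp add: prod.distrib[symmetric])
  then have "real_of_int (\<bar>alt_multinom n k m K id\<bar> * int q) = real_of_int (fact K)"
    using alt_multinom_eq_det[OF K \<open>k > 0\<close> permutes_id]
    by (simp add: sign_id abs_mult mult.assoc)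
  then have "\<bar>alt_multinom n k m K id\<bar> * int q = fact K" by linarith
  then show ?thesis by (metis dvd_triv_left abs_dvd_iff)
qed

section \<open>Nonvanishing in the field and polynomials vanishing on a set\<close>

text \<open>None of the factors \<open>1, ..., K\<close> of \<open>K!\<close> vanishes in the field,
  so no divisor of \<open>K!\<close> does.\<close>

lemma of_int_nonzero_of_dvd_fact:
  fixes N :: int
  assumes "N dvd fact K" and "CHAR('a::field) = 0 \<or> CHAR('a) > K"
  shows "(of_int N :: 'a) \<noteq> 0"
proof
  assume N: "(of_int N :: 'a) = 0"
  obtain t where "fact K = N * t" using assms(1) by (rule dvdE)
  then have "(of_int (fact K) :: 'a) = 0" using N by simp
  then have "(\<Prod>i=1..K. of_nat i :: 'a) = 0" by (simp add: fact_prod)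
  then obtain i where "i \<in> {1..K}" "(of_nat i :: 'a) = 0"
    using prod_zero_iff[of "{1..K}" "of_nat :: nat \<Rightarrow> 'a"] by auto
  then have "CHAR('a) dvd i" "0 < i" "i \<le> K" by (auto simp: of_nat_eq_0_iff_char_dvd)
  then show False using assms(2) dvd_imp_le[of "CHAR('a)" i] by auto
qed

lemma monic_poly_vanishing_on:
  fixes S :: "'a::field set"
  assumes "finite S" "card S \<le> K"
  obtains s where "lead_coeff s = 1" "degree s = K" "\<And>y. y \<in> S \<Longrightarrow> poly s y = 0"
proof -
  let ?g = "\<Prod>b\<in>S. [:- b, 1:]"
  have g: "lead_coeff ?g = 1" "degree ?g = card S"
    by (simp_all only: lead_coeff_prod degree_prod_eq_sum_degree) (simp_all add: degree_prod_eq_sum_degree)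
  show thesis
  \<comment> \<open>The power of the variable pads the degree to exactly \<open>K\<close>, where the
    grid functional reads the coefficient.\<close>
  proof (rule that[of "?g * monom 1 (K - card S)"])
    show "lead_coeff (?g * monom 1 (K - card S)) = 1"
      by (simp only: lead_coeff_mult lead_coeff_monom g(1) mult_1_left)
    have "?g \<noteq> 0" using g(1) by (metis coeff_0 zero_neq_one)
    then show "degree (?g * monom 1 (K - card S)) = K"
      using g(2) assms(2) by (simp add: degree_mult_eq degree_monom_eq)
    show "poly (?g * monom 1 (K - card S)) y = 0" if "y \<in> S" for y
      using that assms(1) by (auto simp: poly_prod)
  qed
qed

section \<open>The two families combined, with indices below \<open>n\<close>\<close>

lemma restricted_sums_two_families:
  fixes c :: "nat \<Rightarrow> 'a::field" and P Q :: "nat \<Rightarrow> 'a poly"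
  assumes A: "\<And>i. i < n \<Longrightarrow> finite (A i) \<and> card (A i) = k"
    and B: "\<And>i. i < n \<Longrightarrow> finite (B i) \<and> card (B i) = l"
    and pos: "h > 0" "k > 0" "l > 0" "m > 0" "n > 0"
    and P: "\<And>i. i < n \<Longrightarrow> lead_coeff (P i) = 1 \<and> degree (P i) = m"
    and Q: "\<And>i. i < n \<Longrightarrow> lead_coeff (Q i) = 1 \<and> degree (Q i) = h"
    and km: "m * (n - 1) \<le> k - 1" and lh: "h * (n - 1) \<le> l - 1"
    and K: "K + (m + 1) * (n choose 2) = n * (k - 1)"
    and L: "L + (h + 1) * (n choose 2) = n * (l - 1)"
    and char: "CHAR('a) = 0 \<or> CHAR('a) > max K L"
    and c: "inj_on c {..<n}"
    and S: "finite S" "card S \<le> K" and T: "finite T" "card T \<le> L"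
  shows "\<exists>x y. (\<forall>i<n. x i \<in> A i \<and> y i \<in> B i) \<and>
    (\<Sum>i<n. x i) \<notin> S \<and> (\<Sum>i<n. y i) \<notin> T \<and>
    (\<forall>j<n. \<forall>i<j. c j * x j * y j \<noteq> c i * x i * y i \<and>
      poly (P j) (x j) \<noteq> poly (P i) (x i) \<and> poly (Q j) (y j) \<noteq> poly (Q i) (y i))"
proof -
  obtain s where s: "lead_coeff s = 1" "degree s = K" "\<And>z. z \<in> S \<Longrightarrow> poly s z = 0"
    using monic_poly_vanishing_on[OF S] by blast
  obtain t where t: "lead_coeff t = 1" "degree t = L" "\<And>z. z \<in> T \<Longrightarrow> poly t z = 0"
    using monic_poly_vanishing_on[OF T] by blast
  \<comment> \<open>\<open>F\<close> and \<open>G\<close> encode the conditions on \<open>x\<close>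
    alone and on \<open>y\<close> alone; only \<open>?V\<close> couples the two.\<close>
  define F where "F x = (\<Prod>j<n. \<Prod>i<j. poly (P j) (x j) - poly (P i) (x i)) * poly s (\<Sum>i<n. x i)" for x
  define G where "G y = (\<Prod>j<n. \<Prod>i<j. poly (Q j) (y j) - poly (Q i) (y i)) * poly t (\<Sum>i<n. y i)" for y
  define M where "M = alt_multinom n k m K id"
  define N where "N = alt_multinom n l h L id"
  have "M dvd fact K" "N dvd fact L"
    unfolding M_def N_def using K L pos km lh by (simp_all add: alt_multinom_dvd_fact)
  then have MN: "(of_int M :: 'a) \<noteq> 0" "(of_int N :: 'a) \<noteq> 0"
    using char of_int_nonzero_of_dvd_fact[of M K, where 'a = 'a]
      of_int_nonzero_of_dvd_fact[of N L, where 'a = 'a] by auto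
  have F: "grid_functional n A (\<lambda>x. (\<Prod>i<n. x i ^ \<sigma> i) * F x) = of_int (sign \<sigma> * M)"
    if "\<sigma> permutes {..<n}" for \<sigma>
    unfolding F_def M_def alt_multinom_permute[OF K pos(2) that, symmetric]
    using A pos P s K that by (intro grid_functional_Vandermonde) auto
  have G: "grid_functional n B (\<lambda>y. (\<Prod>i<n. y i ^ \<sigma> i) * G y) = of_int (sign \<sigma> * N)"
    if "\<sigma> permutes {..<n}" for \<sigma>
    unfolding G_def N_def alt_multinom_permute[OF L pos(3) that, symmetric]
    using B pos Q t L that by (intro grid_functional_Vandermonde) auto
  let ?V = "\<lambda>x y. \<Prod>j<n. \<Prod>i<j. c j * x j * y j - c i * x i * y i"
  \<comment> \<open>For fixed \<open>x\<close> the inner functional acts on \<open>y\<close> only,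
    and each Leibniz term of \<open>?V\<close> splits into a factor in \<open>x\<close> and one in
    \<open>y\<close>.\<close>
  have "grid_functional n A (\<lambda>x. grid_functional n B (\<lambda>y. ?V x y * F x * G y))
      = grid_functional n A (\<lambda>x. grid_functional n B (\<lambda>y. \<Sum>\<sigma> | \<sigma> permutes {..<n}.
          (of_int (sign \<sigma>) * (\<Prod>i<n. c i ^ \<sigma> i) * ((\<Prod>i<n. x i ^ \<sigma> i) * F x)) *
          ((\<Prod>i<n. y i ^ \<sigma> i) * G y)))"
    unfolding Vandermonde_leibniz
    by (simp add: sum_distrib_left sum_distrib_right prod.distrib power_mult_distrib mult_ac)
  also have "\<dots> = grid_functional n A (\<lambda>x. \<Sum>\<sigma> | \<sigma> permutes {..<n}.
          (of_int (sign \<sigma>) * (\<Prod>i<n. c i ^ \<sigma> i) * ((\<Prod>i<n. x i ^ \<sigma> i) * F x)) *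
          of_int (sign \<sigma> * N))"
    unfolding grid_functional_sum grid_functional_cmult
    by (intro sum.cong refl) (simp only: G mem_Collect_eq)
  also have "\<dots> = grid_functional n A (\<lambda>x. \<Sum>\<sigma> | \<sigma> permutes {..<n}.
          (of_int (sign \<sigma>) * (\<Prod>i<n. c i ^ \<sigma> i) * of_int (sign \<sigma> * N)) *
          ((\<Prod>i<n. x i ^ \<sigma> i) * F x))"
    by (simp only: mult_ac)
  also have "\<dots> = (\<Sum>\<sigma> | \<sigma> permutes {..<n}.
          (of_int (sign \<sigma>) * (\<Prod>i<n. c i ^ \<sigma> i) * of_int (sign \<sigma> * N)) * of_int (sign \<sigma> * M))"
    unfolding grid_functional_sum grid_functional_cmult
    by (intro sum.cong refl) (simp only: F mem_Collect_eq)
  \<comment> \<open>Three copies of \<open>sign \<sigma>\<close> multiply to one, which leaves the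
    Leibniz expansion of the Vandermonde product of the \<open>c i\<close>.\<close>
  also have "\<dots> = (\<Sum>\<sigma> | \<sigma> permutes {..<n}.
          (of_int (sign \<sigma>) * (\<Prod>i<n. c i ^ \<sigma> i)) * (of_int N * of_int M))"
    by (intro sum.cong refl) (simp add: sign_def)
  also have "\<dots> = (\<Prod>j<n. \<Prod>i<j. c j - c i) * (of_int N * of_int M)"
    by (simp only: Vandermonde_leibniz sum_distrib_right)
  also have "\<dots> \<noteq> 0"
  proof -
    have "c j - c i \<noteq> 0" if "i < j" "j < n" for i j
      using inj_onD[OF c, of j i] that by auto
    then show ?thesis using MN by auto
  qed
  finally have "grid_functional n A (\<lambda>x. grid_functional n B (\<lambda>y. ?V x y * F x * G y)) \<noteq> 0" .
  from grid_functional_nonzeroD[OF this] obtain x where x: "\<And>i. i < n \<Longrightarrow> x i \<in> A i"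
      "grid_functional n B (\<lambda>y. ?V x y * F x * G y) \<noteq> 0"
    by blast
  from grid_functional_nonzeroD[OF x(2)] obtain y where y: "\<And>i. i < n \<Longrightarrow> y i \<in> B i" "?V x y * F x * G y \<noteq> 0"
    by blast
  have sums: "(\<Sum>i<n. x i) \<notin> S" "(\<Sum>i<n. y i) \<notin> T"
    using y(2) s(3) t(3) by (auto simp: F_def G_def)
  have distinct: "c j * x j * y j \<noteq> c i * x i * y i" "poly (P j) (x j) \<noteq> poly (P i) (x i)"
      "poly (Q j) (y j) \<noteq> poly (Q i) (y i)" if "i < j" "j < n" for i j
    using y(2) that by (fastforce simp: F_def G_def)+
  show ?thesis
    by (rule exI[of _ x], rule exI[of _ y]) (simp add: x(1) y(1) sums distinct)
qed

section \<open>Integer bounds and indices from 1 to \<open>n\<close>\<close>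

theorem theorem1p2:
  fixes h k l m n :: nat
    and K L :: int
    and c :: "nat \<Rightarrow> 'a::field"
    and A B :: "nat \<Rightarrow> 'a set"
    and P Q :: "nat \<Rightarrow> 'a poly"
    and S T :: "'a set"
  assumes "h > 0" and "k > 0" and "l > 0" and "m > 0" and "n > 0"
    and "int k - 1 \<ge> int m * (int n - 1)"
    and "int l - 1 \<ge> int h * (int n - 1)"
    and "K = (int k - 1) * int n - (int m + 1) * int (n choose 2)"
    and "L = (int l - 1) * int n - (int h + 1) * int (n choose 2)"
    and "field_ch TYPE('a) > enat (nat (max K L))"
    and "inj_on c {1..n}"
    and "\<forall>i\<in>{1..n}. finite (A i) \<and> card (A i) = k"
    and "\<forall>i\<in>{1..n}. finite (B i) \<and> card (B i) = l"
    and "\<forall>i\<in>{1..n}. lead_coeff (P i) = 1 \<and> degree (P i) = m"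
    and "\<forall>i\<in>{1..n}. lead_coeff (Q i) = 1 \<and> degree (Q i) = h"
    and "finite S" and "int (card S) \<le> K"
    and "finite T" and "int (card T) \<le> L"
  shows "\<exists>a b :: nat \<Rightarrow> 'a.
           (\<forall>i\<in>{1..n}. a i \<in> A i) \<and> (\<forall>i\<in>{1..n}. b i \<in> B i) \<and>
           (\<Sum>i=1..n. a i) \<notin> S \<and> (\<Sum>i=1..n. b i) \<notin> T \<and>
           (\<forall>i j. 1 \<le> i \<and> i < j \<and> j \<le> n \<longrightarrow>
              a i * b i * c i \<noteq> a j * b j * c j \<and>
              poly (P i) (a i) \<noteq> poly (P j) (a j) \<and>
              poly (Q i) (b i) \<noteq> poly (Q j) (b j))"
proof -
  \<comment> \<open>The cardinality bounds force \<open>K\<close> and \<open>L\<close> to be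
    nonnegative, so \<open>nat\<close> loses nothing.\<close>
  have nonneg: "K \<ge> 0" "L \<ge> 0" using assms(17,19) by linarith+
  have sub1: "int (u - 1) = int u - 1" if "u > 0" for u :: nat
    using that by (simp add: of_nat_diff)
  have "int (m * (n - 1)) \<le> int (k - 1)" "int (h * (n - 1)) \<le> int (l - 1)"
    using assms(6,7) by (simp_all only: of_nat_mult sub1 assms(1-5))
  then have le: "m * (n - 1) \<le> k - 1" "h * (n - 1) \<le> l - 1" by linarith+
  have "int (nat K + (m + 1) * (n choose 2)) = int (n * (k - 1))"
       "int (nat L + (h + 1) * (n choose 2)) = int (n * (l - 1))"
    using nonneg unfolding of_nat_mult of_nat_add sub1[OF assms(2)] sub1[OF assms(3)]
    by (simp_all add: assms(8,9) mult.commute)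
  then have KL: "nat K + (m + 1) * (n choose 2) = n * (k - 1)"
       "nat L + (h + 1) * (n choose 2) = n * (l - 1)" by linarith+
  have char: "CHAR('a) = 0 \<or> CHAR('a) > max (nat K) (nat L)"
    using assms(10) by (auto simp: field_ch_CHAR max_def split: if_splits)
  have inj: "inj_on (\<lambda>i. c (Suc i)) {..<n}"
    using assms(11) comp_inj_on[of Suc "{..<n}" c]
    by (simp add: image_Suc_lessThan comp_def)
  have "finite (A (Suc i)) \<and> card (A (Suc i)) = k" "finite (B (Suc i)) \<and> card (B (Suc i)) = l"
    "lead_coeff (P (Suc i)) = 1 \<and> degree (P (Suc i)) = m"
    "lead_coeff (Q (Suc i)) = 1 \<and> degree (Q (Suc i)) = h" if "i < n" for i
  proof -
    have "Suc i \<in> {1..n}" using that by simp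
    then show "finite (A (Suc i)) \<and> card (A (Suc i)) = k" "finite (B (Suc i)) \<and> card (B (Suc i)) = l"
      "lead_coeff (P (Suc i)) = 1 \<and> degree (P (Suc i)) = m"
      "lead_coeff (Q (Suc i)) = 1 \<and> degree (Q (Suc i)) = h"
      using assms(12-15) by blast+
  qed
  note families = this
  have cards: "card S \<le> nat K" "card T \<le> nat L"
    using assms(17,19) by linarith+
  have "\<exists>x y. (\<forall>i<n. x i \<in> A (Suc i) \<and> y i \<in> B (Suc i)) \<and>
    (\<Sum>i<n. x i) \<notin> S \<and> (\<Sum>i<n. y i) \<notin> T \<and>
    (\<forall>j<n. \<forall>i<j. c (Suc j) * x j * y j \<noteq> c (Suc i) * x i * y i \<and>
      poly (P (Suc j)) (x j) \<noteq> poly (P (Suc i)) (x i) \<and>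
      poly (Q (Suc j)) (y j) \<noteq> poly (Q (Suc i)) (y i))"
    by (rule restricted_sums_two_families[where A = "\<lambda>i. A (Suc i)" and B = "\<lambda>i. B (Suc i)"
          and P = "\<lambda>i. P (Suc i)" and Q = "\<lambda>i. Q (Suc i)" and c = "\<lambda>i. c (Suc i)"
          and k = k and l = l and m = m and h = h and K = "nat K" and L = "nat L"])
      ((rule families; assumption) | rule assms le KL char inj cards)+
  then obtain x y where xy:
    "\<And>i. i < n \<Longrightarrow> x i \<in> A (Suc i)" "\<And>i. i < n \<Longrightarrow> y i \<in> B (Suc i)"
    "(\<Sum>i<n. x i) \<notin> S" "(\<Sum>i<n. y i) \<notin> T"
    "\<And>i j. i < j \<Longrightarrow> j < n \<Longrightarrow> c (Suc j) * x j * y j \<noteq> c (Suc i) * x i * y i"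
    "\<And>i j. i < j \<Longrightarrow> j < n \<Longrightarrow> poly (P (Suc j)) (x j) \<noteq> poly (P (Suc i)) (x i)"
    "\<And>i j. i < j \<Longrightarrow> j < n \<Longrightarrow> poly (Q (Suc j)) (y j) \<noteq> poly (Q (Suc i)) (y i)"
    by blast
  have shift: "(\<Sum>i=1..n. z (i - 1)) = (\<Sum>i<n. z i)" for z :: "nat \<Rightarrow> 'a"
    using sum.atLeast1_atMost_eq[of "\<lambda>i. z (i - 1)" n] by simp
  \<comment> \<open>On \<open>{1..n}\<close> the shift \<open>i - 1\<close> undoes the
    \<open>Suc\<close> in the reindexed families.\<close>
  show ?thesis
  proof (rule exI[of _ "\<lambda>i. x (i - 1)"], rule exI[of _ "\<lambda>i. y (i - 1)"],
      intro conjI ballI allI impI)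
    fix i assume "i \<in> {1..n}"
    then show "x (i - 1) \<in> A i" "y (i - 1) \<in> B i"
      using xy(1,2)[of "i - 1"] by auto
  next
    fix i j assume "1 \<le> i \<and> i < j \<and> j \<le> n"
    then have ij: "i - 1 < j - 1" "j - 1 < n" "Suc (i - 1) = i" "Suc (j - 1) = j" by auto
    show "x (i - 1) * y (i - 1) * c i \<noteq> x (j - 1) * y (j - 1) * c j"
         "poly (P i) (x (i - 1)) \<noteq> poly (P j) (x (j - 1))"
         "poly (Q i) (y (i - 1)) \<noteq> poly (Q j) (y (j - 1))"
      using xy(5-7)[OF ij(1,2)] unfolding ij by (auto simp: mult_ac)
  qed (use xy(3,4) shift in auto)
qed

end
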